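(* Let $K$ be an infinite compact metric space with at least two connected components. Assume that one connected component has at least two points. Then, for every $e\in K$, the operator $T_{f,e}\colon\mathcal F(K,e)\to\mathcal F(K,e)$ admits a non-trivial invariant subspace for every Lipschitz map $f\colon K\to K$.
   Context: $\mathbb K$ denotes $\mathbb R$ or $\mathbb C$ (the scalar field). For a metric space $M$ and $e\in M$, $\mathrm{Lip}_0(M,e)$ is the Banach space of Lipschitz functions $\varphi\colon M\to\mathbb K$ with $\varphi(e)=0$, normed by the best Lipschitz constant. For $x\in M$, $\delta(x)=\delta_e(x)\in \mathrm{Lip}_0(M,e)^*$ is the evaluation functional $\varphi\mapsto\varphi(x)$. The Lipschitz-free space with basepoint $e$ is $\mathcal F(M,e):=\overline{\mathrm{span}}\{\delta(x):x\in M\}\subset \mathrm{Lip}_0(M,e)^*$ (norm closure). For a Lipschitz map $f\colon M\to M$ (not assumed to fix $e$), $T_{f,e}\colon\mathcal F(M,e)\to\mathcal F(M,e)$ is the unique bounded linear operator with $T_{f,e}(\delta(x))=\delta(f(x))-\delta(f(e))$ for all $x\in M$. A non-trivial invariant subspace of a bounded operator $T\colon X\to X$ is a closed linear subspace $S$ with $\{0\}\subsetneq S\subsetneq X$ and $T(S)\subset S$. *)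

theory Defs
  imports "HOL-Analysis.Analysis" "HOL-Library.Function_Algebras"
begin

text \<open>
  The metric space is a subset \<open>K\<close> of a type of class \<open>metric_space\<close>, with the induced metric.
  The scalars form a type \<open>'k\<close> of class \<open>real_normed_field\<close>, to be instantiated by
  \<open>real\<close> and \<open>complex\<close>.  Functions on \<open>K\<close> are represented by functions vanishing off \<open>K\<close>,
  functionals on the Lipschitz space by functionals vanishing off that space, and operators on the
  free space by maps vanishing off the free space; with these conventions equality of
  representatives is equality of the represented objects.
\<close>

definition fscale :: "'k \<Rightarrow> ('b \<Rightarrow> 'k) \<Rightarrow> 'b \<Rightarrow> 'k::real_normed_field"
  where "fscale c f = (\<lambda>x. c * f x)"

definition Lip0 :: "'a::metric_space set \<Rightarrow> 'a \<Rightarrow> ('a \<Rightarrow> 'k::real_normed_field) set"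
  where "Lip0 K e = {\<phi>. (\<exists>C. C-lipschitz_on K \<phi>) \<and> \<phi> e = 0 \<and> (\<forall>x. x \<notin> K \<longrightarrow> \<phi> x = 0)}"

definition lip_norm :: "'a::metric_space set \<Rightarrow> ('a \<Rightarrow> 'k::real_normed_field) \<Rightarrow> real"
  where "lip_norm K \<phi> = Inf {C. C-lipschitz_on K \<phi>}"

definition Lip0_dual :: "'a::metric_space set \<Rightarrow> 'a \<Rightarrow> (('a \<Rightarrow> 'k::real_normed_field) \<Rightarrow> 'k) set"
  where "Lip0_dual K e = {\<Phi>.
    (\<forall>\<phi>\<in>Lip0 K e. \<forall>\<psi>\<in>Lip0 K e. \<Phi> (\<phi> + \<psi>) = \<Phi> \<phi> + \<Phi> \<psi>) \<and>
    (\<forall>c. \<forall>\<phi>\<in>Lip0 K e. \<Phi> (fscale c \<phi>) = c * \<Phi> \<phi>) \<and>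
    (\<exists>C. \<forall>\<phi>\<in>Lip0 K e. norm (\<Phi> \<phi>) \<le> C * lip_norm K \<phi>) \<and>
    (\<forall>\<phi>. \<phi> \<notin> Lip0 K e \<longrightarrow> \<Phi> \<phi> = 0)}"

definition dual_norm ::
    "'a::metric_space set \<Rightarrow> 'a \<Rightarrow> (('a \<Rightarrow> 'k::real_normed_field) \<Rightarrow> 'k) \<Rightarrow> real"
  where "dual_norm K e \<Phi> = (SUP \<phi>\<in>{\<phi>\<in>Lip0 K e. lip_norm K \<phi> \<le> 1}. norm (\<Phi> \<phi>))"

text \<open>
  The locale \<open>Metric_space\<close> requires nonnegativity also outside the carrier, where the supremum
  in \<open>dual_norm\<close> need not be bounded; hence the case distinction.
\<close>

definition dual_dist ::
    "'a::metric_space set \<Rightarrow> 'a \<Rightarrow> (('a \<Rightarrow> 'k::real_normed_field) \<Rightarrow> 'k) \<Rightarrow>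
     (('a \<Rightarrow> 'k) \<Rightarrow> 'k) \<Rightarrow> real"
  where "dual_dist K e \<Phi> \<Psi> =
    (if \<Phi> \<in> Lip0_dual K e \<and> \<Psi> \<in> Lip0_dual K e then dual_norm K e (\<Phi> - \<Psi>) else 0)"

definition dual_topology ::
    "'a::metric_space set \<Rightarrow> 'a \<Rightarrow> (('a \<Rightarrow> 'k::real_normed_field) \<Rightarrow> 'k) topology"
  where "dual_topology K e = Metric_space.mtopology (Lip0_dual K e) (dual_dist K e)"

definition evalf ::
    "'a::metric_space set \<Rightarrow> 'a \<Rightarrow> 'a \<Rightarrow> ('a \<Rightarrow> 'k::real_normed_field) \<Rightarrow> 'k"
  where "evalf K e x = (\<lambda>\<phi>. if \<phi> \<in> Lip0 K e then \<phi> x else 0)"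

definition free_space ::
    "'a::metric_space set \<Rightarrow> 'a \<Rightarrow> (('a \<Rightarrow> 'k::real_normed_field) \<Rightarrow> 'k) set"
  where "free_space K e = dual_topology K e closure_of module.span fscale (evalf K e ` K)"

definition free_topology ::
    "'a::metric_space set \<Rightarrow> 'a \<Rightarrow> (('a \<Rightarrow> 'k::real_normed_field) \<Rightarrow> 'k) topology"
  where "free_topology K e = subtopology (dual_topology K e) (free_space K e)"

definition bounded_operator ::
    "'a::metric_space set \<Rightarrow> 'a \<Rightarrow>
     ((('a \<Rightarrow> 'k::real_normed_field) \<Rightarrow> 'k) \<Rightarrow> (('a \<Rightarrow> 'k) \<Rightarrow> 'k)) \<Rightarrow> bool"
  where "bounded_operator K e T \<longleftrightarrow>
    (\<forall>\<Phi>\<in>free_space K e. T \<Phi> \<in> free_space K e) \<and>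
    (\<forall>\<Phi>\<in>free_space K e. \<forall>\<Psi>\<in>free_space K e. T (\<Phi> + \<Psi>) = T \<Phi> + T \<Psi>) \<and>
    (\<forall>c. \<forall>\<Phi>\<in>free_space K e. T (fscale c \<Phi>) = fscale c (T \<Phi>)) \<and>
    (\<exists>C. \<forall>\<Phi>\<in>free_space K e. dual_norm K e (T \<Phi>) \<le> C * dual_norm K e \<Phi>) \<and>
    (\<forall>\<Phi>. \<Phi> \<notin> free_space K e \<longrightarrow> T \<Phi> = 0)"

text \<open>The lemma \<open>lip_operator_unique_exists\<close> below justifies the definite description.\<close>

definition lip_operator ::
    "'a::metric_space set \<Rightarrow> 'a \<Rightarrow> ('a \<Rightarrow> 'a) \<Rightarrow>
     (('a \<Rightarrow> 'k::real_normed_field) \<Rightarrow> 'k) \<Rightarrow> (('a \<Rightarrow> 'k) \<Rightarrow> 'k)"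
  where "lip_operator K e f = (THE T. bounded_operator K e T \<and>
    (\<forall>x\<in>K. T (evalf K e x) = evalf K e (f x) - evalf K e (f e)))"

definition nontrivial_invariant_subspace ::
    "'a::metric_space set \<Rightarrow> 'a \<Rightarrow>
     ((('a \<Rightarrow> 'k::real_normed_field) \<Rightarrow> 'k) \<Rightarrow> (('a \<Rightarrow> 'k) \<Rightarrow> 'k)) \<Rightarrow>
     (('a \<Rightarrow> 'k) \<Rightarrow> 'k) set \<Rightarrow> bool"
  where "nontrivial_invariant_subspace K e T S \<longleftrightarrow>
    module.subspace fscale S \<and> closedin (free_topology K e) S \<and>
    {0} \<subset> S \<and> S \<subset> free_space K e \<and> T ` S \<subseteq> S"


subsection \<open>Well-definedness\<close>

interpretation fs: module "fscale :: 'k \<Rightarrow> ('b \<Rightarrow> 'k) \<Rightarrow> 'b \<Rightarrow> 'k::real_normed_field"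
  by unfold_locales (auto simp: fscale_def fun_eq_iff algebra_simps)

lemma lipschitz_on_scale:
  fixes \<phi> :: "'a::metric_space \<Rightarrow> 'k::real_normed_field"
  assumes "C-lipschitz_on K \<phi>" shows "(norm c * C)-lipschitz_on K (fscale c \<phi>)"
proof (rule lipschitz_onI)
  fix x y assume "x \<in> K" "y \<in> K"
  then have "norm c * dist (\<phi> x) (\<phi> y) \<le> norm c * (C * dist x y)"
    using assms by (intro mult_left_mono) (auto dest: lipschitz_onD)
  then show "dist (fscale c \<phi> x) (fscale c \<phi> y) \<le> norm c * C * dist x y"
    by (simp add: fscale_def dist_norm norm_mult mult.assoc flip: right_diff_distrib)
qed (use lipschitz_on_nonneg[OF assms] in auto)

lemma subspace_Lip0: "fs.subspace (Lip0 K e :: ('a::metric_space \<Rightarrow> 'k::real_normed_field) set)"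
proof (rule fs.subspaceI)
  show "(0 :: 'a \<Rightarrow> 'k) \<in> Lip0 K e"
    by (auto simp: Lip0_def intro!: exI[of _ 0] lipschitz_onI)
  show "\<phi> + \<psi> \<in> Lip0 K e" if "\<phi> \<in> Lip0 K e" "\<psi> \<in> Lip0 K e" for \<phi> \<psi> :: "'a \<Rightarrow> 'k"
    using that lipschitz_on_add[of _ K \<phi> _ \<psi>] by (auto simp: Lip0_def plus_fun_def)
  show "fscale c \<phi> \<in> Lip0 K e" if "\<phi> \<in> Lip0 K e" for c and \<phi> :: "'a \<Rightarrow> 'k"
    using that by (auto simp: Lip0_def intro: lipschitz_on_scale) (auto simp: fscale_def)
qed

lemmas Lip0_closed = fs.subspace_0[OF subspace_Lip0] fs.subspace_add[OF subspace_Lip0]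
  fs.subspace_scale[OF subspace_Lip0]

lemma lip_norm:
  assumes "\<phi> \<in> Lip0 K e" shows "(lip_norm K \<phi>)-lipschitz_on K \<phi>"
proof -
  let ?S = "{C. C-lipschitz_on K \<phi>}"
  have ne: "?S \<noteq> {}" using assms by (auto simp: Lip0_def)
  have "0 \<le> Inf ?S" using ne by (intro cInf_greatest) (auto dest: lipschitz_on_nonneg)
  moreover have "dist (\<phi> x) (\<phi> y) \<le> Inf ?S * dist x y" if "x \<in> K" "y \<in> K" for x y
  proof (cases "x = y")
    case False
    have "dist (\<phi> x) (\<phi> y) / dist x y \<le> Inf ?S"
      using ne False that
      by (intro cInf_greatest) (auto simp: divide_le_eq mult.commute dest: lipschitz_onD)
    then show ?thesis using False by (simp add: divide_le_eq)
  qed auto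
  ultimately show ?thesis unfolding lip_norm_def by (intro lipschitz_onI) auto
qed

lemma lip_norm_le: "C-lipschitz_on K \<phi> \<Longrightarrow> lip_norm K \<phi> \<le> C"
  unfolding lip_norm_def
  by (rule cInf_lower) (auto intro!: bdd_belowI[of _ 0] dest: lipschitz_on_nonneg)

lemma lip_norm_nonneg: "\<phi> \<in> Lip0 K e \<Longrightarrow> 0 \<le> lip_norm K \<phi>"
  using lip_norm lipschitz_on_nonneg by blast

lemma bdd_above_dual_norm:
  fixes \<Phi> :: "('a::metric_space \<Rightarrow> 'k::real_normed_field) \<Rightarrow> 'k"
  assumes "\<Phi> \<in> Lip0_dual K e"
  shows "bdd_above ((\<lambda>\<phi>. norm (\<Phi> \<phi>)) ` {\<phi>\<in>Lip0 K e. lip_norm K \<phi> \<le> 1})"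
proof -
  obtain C where C: "\<forall>\<phi>\<in>Lip0 K e. norm (\<Phi> \<phi>) \<le> C * lip_norm K \<phi>"
    using assms by (auto simp: Lip0_dual_def)
  show ?thesis
  proof (rule bdd_aboveI2)
    fix \<psi> :: "'a \<Rightarrow> 'k" assume \<psi>: "\<psi> \<in> {\<phi>\<in>Lip0 K e. lip_norm K \<phi> \<le> 1}"
    have "norm (\<Phi> \<psi>) \<le> C * lip_norm K \<psi>" using C \<psi> by auto
    also have "\<dots> \<le> \<bar>C\<bar> * 1" using \<psi> lip_norm_nonneg[of \<psi> K e] by (intro mult_mono) auto
    finally show "norm (\<Phi> \<psi>) \<le> \<bar>C\<bar>" by simp
  qed
qed

lemma norm_le_dual_norm:
  assumes "\<Phi> \<in> Lip0_dual K e" "\<phi> \<in> Lip0 K e"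
  shows "norm (\<Phi> \<phi>) \<le> dual_norm K e \<Phi> * lip_norm K \<phi>"
proof -
  obtain C where C: "\<forall>\<phi>\<in>Lip0 K e. norm (\<Phi> \<phi>) \<le> C * lip_norm K \<phi>"
    using assms(1) by (auto simp: Lip0_dual_def)
  note bdd = bdd_above_dual_norm[OF assms(1)]
  show ?thesis
  proof (cases "lip_norm K \<phi> = 0")
    case True
    then show ?thesis using C assms(2) by force
  next
    case False
    let ?r = "lip_norm K \<phi>"
    have r: "?r > 0" using False lip_norm_nonneg[OF assms(2)] by simp
    let ?\<psi> = "fscale (of_real (1 / ?r)) \<phi>"
    have "(norm (of_real (1 / ?r) :: 'b) * ?r)-lipschitz_on K ?\<psi>"
      by (rule lipschitz_on_scale[OF lip_norm[OF assms(2)]])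
    then have "1-lipschitz_on K ?\<psi>" using r by (simp add: norm_divide)
    then have "?\<psi> \<in> {\<phi>\<in>Lip0 K e. lip_norm K \<phi> \<le> 1}"
      using lip_norm_le assms(2) fs.subspace_scale[OF subspace_Lip0] by blast
    then have "norm (\<Phi> ?\<psi>) \<le> dual_norm K e \<Phi>"
      unfolding dual_norm_def by (rule cSUP_upper[OF _ bdd])
    moreover have "\<Phi> ?\<psi> = of_real (1 / ?r) * \<Phi> \<phi>"
      using assms by (simp add: Lip0_dual_def)
    ultimately show ?thesis using r by (simp add: norm_mult norm_divide divide_le_eq)
  qed
qed

lemma dual_norm_le:
  assumes "\<And>\<phi>. \<phi> \<in> Lip0 K e \<Longrightarrow> norm (\<Phi> \<phi>) \<le> C * lip_norm K \<phi>" "0 \<le> C"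
  shows "dual_norm K e \<Phi> \<le> C"
  unfolding dual_norm_def
proof (rule cSUP_least)
  have "lip_norm K (0 :: 'a \<Rightarrow> 'b) \<le> 0"
    by (rule lip_norm_le) (auto intro: lipschitz_onI)
  then have "(0 :: 'a \<Rightarrow> 'b) \<in> {\<phi> \<in> Lip0 K e. lip_norm K \<phi> \<le> 1}"
    using fs.subspace_0[OF subspace_Lip0] by auto
  then show "{\<phi> \<in> Lip0 K e. lip_norm K \<phi> \<le> 1} \<noteq> ({} :: ('a \<Rightarrow> 'b) set)" by blast
next
  fix \<phi> :: "'a \<Rightarrow> 'b" assume \<phi>: "\<phi> \<in> {\<phi> \<in> Lip0 K e. lip_norm K \<phi> \<le> 1}"
  have "norm (\<Phi> \<phi>) \<le> C * lip_norm K \<phi>" using assms \<phi> by auto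
  also have "\<dots> \<le> C * 1" using \<phi> assms by (intro mult_left_mono) auto
  finally show "norm (\<Phi> \<phi>) \<le> C" by simp
qed

lemma dual_norm_nonneg:
  fixes \<Phi> :: "('a::metric_space \<Rightarrow> 'k::real_normed_field) \<Rightarrow> 'k"
  assumes "\<Phi> \<in> Lip0_dual K e" shows "0 \<le> dual_norm K e \<Phi>"
proof -
  note bdd_above_dual_norm[OF assms]
  moreover have "lip_norm K (0 :: 'a \<Rightarrow> 'k) \<le> 0"
    by (rule lip_norm_le) (auto intro: lipschitz_onI)
  ultimately have "norm (\<Phi> 0) \<le> dual_norm K e \<Phi>"
    unfolding dual_norm_def by (intro cSUP_upper) (auto simp: Lip0_closed simp del: zero_fun_apply)
  then show ?thesis by (meson norm_ge_zero order_trans)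
qed

lemma subspace_Lip0_dual:
  "fs.subspace (Lip0_dual K e :: (('a::metric_space \<Rightarrow> 'k::real_normed_field) \<Rightarrow> 'k) set)"
proof (rule fs.subspaceI)
  show "0 \<in> (Lip0_dual K e :: (('a \<Rightarrow> 'k) \<Rightarrow> 'k) set)"
    by (auto simp: Lip0_dual_def intro: exI[of _ 0])
next
  fix \<Phi> \<Psi> :: "('a \<Rightarrow> 'k) \<Rightarrow> 'k" assume *: "\<Phi> \<in> Lip0_dual K e" "\<Psi> \<in> Lip0_dual K e"
  have "norm (\<Phi> \<phi> + \<Psi> \<phi>) \<le> (dual_norm K e \<Phi> + dual_norm K e \<Psi>) * lip_norm K \<phi>"
    if "\<phi> \<in> Lip0 K e" for \<phi> :: "'a \<Rightarrow> 'k"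
    using norm_le_dual_norm[OF *(1) that] norm_le_dual_norm[OF *(2) that]
      norm_triangle_ineq[of "\<Phi> \<phi>" "\<Psi> \<phi>"] by (simp add: distrib_right)
  then have "\<exists>C. \<forall>\<phi>\<in>Lip0 K e. norm ((\<Phi> + \<Psi>) \<phi>) \<le> C * lip_norm K \<phi>" by auto
  then show "\<Phi> + \<Psi> \<in> Lip0_dual K e"
    using * unfolding Lip0_dual_def mem_Collect_eq by (intro conjI) (auto simp: algebra_simps)
next
  fix c :: 'k and \<Phi> :: "('a \<Rightarrow> 'k) \<Rightarrow> 'k" assume *: "\<Phi> \<in> Lip0_dual K e"
  have "norm (c * \<Phi> \<phi>) \<le> (norm c * dual_norm K e \<Phi>) * lip_norm K \<phi>"
    if "\<phi> \<in> Lip0 K e" for \<phi> :: "'a \<Rightarrow> 'k"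
    using norm_le_dual_norm[OF * that] by (simp add: norm_mult mult.assoc mult_left_mono)
  then have "\<exists>C. \<forall>\<phi>\<in>Lip0 K e. norm (fscale c \<Phi> \<phi>) \<le> C * lip_norm K \<phi>"
    unfolding fscale_def by blast
  then show "fscale c \<Phi> \<in> Lip0_dual K e"
    using * unfolding Lip0_dual_def mem_Collect_eq
    by (intro conjI) (auto simp: fscale_def algebra_simps)
qed

lemma dual_norm_eq_0:
  assumes "\<Phi> \<in> Lip0_dual K e" "dual_norm K e \<Phi> = 0" shows "\<Phi> = 0"
proof
  fix \<phi> :: "'a \<Rightarrow> 'b" show "\<Phi> \<phi> = 0 \<phi>"
    using assms norm_le_dual_norm[OF assms(1), of \<phi>]
    by (cases "\<phi> \<in> Lip0 K e") (auto simp: Lip0_dual_def)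
qed

lemma dual_norm_triangle:
  assumes "\<Phi> \<in> Lip0_dual K e" "\<Psi> \<in> Lip0_dual K e"
  shows "dual_norm K e (\<Phi> + \<Psi>) \<le> dual_norm K e \<Phi> + dual_norm K e \<Psi>"
proof (rule dual_norm_le)
  fix \<phi> :: "'a \<Rightarrow> 'b" assume "\<phi> \<in> Lip0 K e"
  then show "norm ((\<Phi> + \<Psi>) \<phi>) \<le> (dual_norm K e \<Phi> + dual_norm K e \<Psi>) * lip_norm K \<phi>"
    using norm_le_dual_norm[OF assms(1)] norm_le_dual_norm[OF assms(2)]
      norm_triangle_ineq[of "\<Phi> \<phi>" "\<Psi> \<phi>"] by (fastforce simp: distrib_right)
qed (simp add: assms dual_norm_nonneg)

lemma dual_norm_minus_commute: "dual_norm K e (\<Phi> - \<Psi>) = dual_norm K e (\<Psi> - \<Phi>)"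
  by (simp add: dual_norm_def norm_minus_commute)

lemma Metric_space_dual: "Metric_space (Lip0_dual K e) (dual_dist K e)"
proof
  note diff = fs.subspace_diff[OF subspace_Lip0_dual]
  show "0 \<le> dual_dist K e \<Phi> \<Psi>" for \<Phi> \<Psi> :: "('a \<Rightarrow> 'b) \<Rightarrow> 'b"
    by (simp add: dual_dist_def diff dual_norm_nonneg)
  show "dual_dist K e \<Phi> \<Psi> = dual_dist K e \<Psi> \<Phi>" for \<Phi> \<Psi> :: "('a \<Rightarrow> 'b) \<Rightarrow> 'b"
    by (auto simp: dual_dist_def dual_norm_minus_commute)
  show "dual_dist K e \<Phi> \<Psi> = 0 \<longleftrightarrow> \<Phi> = \<Psi>"
    if *: "\<Phi> \<in> Lip0_dual K e" "\<Psi> \<in> Lip0_dual K e" for \<Phi> \<Psi> :: "('a \<Rightarrow> 'b) \<Rightarrow> 'b"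
  proof
    assume "dual_dist K e \<Phi> \<Psi> = 0"
    then have "\<Phi> - \<Psi> = 0" using * by (intro dual_norm_eq_0[OF diff]) (auto simp: dual_dist_def)
    then show "\<Phi> = \<Psi>" by simp
  next
    assume "\<Phi> = \<Psi>"
    moreover have "dual_norm K e (0 :: ('a \<Rightarrow> 'b) \<Rightarrow> 'b) = 0"
      by (intro order_antisym dual_norm_nonneg fs.subspace_0[OF subspace_Lip0_dual] dual_norm_le) auto
    ultimately show "dual_dist K e \<Phi> \<Psi> = 0" by (simp add: dual_dist_def)
  qed
  show "dual_dist K e \<Phi> \<Theta> \<le> dual_dist K e \<Phi> \<Psi> + dual_dist K e \<Psi> \<Theta>"
    if "\<Phi> \<in> Lip0_dual K e" "\<Psi> \<in> Lip0_dual K e" "\<Theta> \<in> Lip0_dual K e"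
    for \<Phi> \<Psi> \<Theta> :: "('a \<Rightarrow> 'b) \<Rightarrow> 'b"
    using that dual_norm_triangle[OF diff[OF that(1,2)] diff[OF that(2,3)]]
    by (simp add: dual_dist_def)
qed

lemma evalf_in_dual:
  assumes "x \<in> K" "e \<in> K" shows "evalf K e x \<in> Lip0_dual K e"
proof -
  have "norm (\<phi> x) \<le> dist x e * lip_norm K \<phi>" if "\<phi> \<in> Lip0 K e" for \<phi> :: "'a \<Rightarrow> 'b"
    using lipschitz_onD[OF lip_norm[OF that] assms] that
    by (simp add: Lip0_def mult.commute)
  then show ?thesis
    unfolding Lip0_dual_def evalf_def mem_Collect_eq
    by (intro conjI) (auto simp: Lip0_closed, simp add: fscale_def)
qed

lemma span_evalf_subset: "e \<in> K \<Longrightarrow> fs.span (evalf K e ` K) \<subseteq> Lip0_dual K e"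
  by (intro fs.span_minimal subspace_Lip0_dual) (auto intro: evalf_in_dual)

lemma in_free_space_iff:
  assumes "e \<in> K"
  shows "\<Phi> \<in> free_space K e \<longleftrightarrow> \<Phi> \<in> Lip0_dual K e \<and>
    (\<forall>r>0. \<exists>\<Psi>\<in>fs.span (evalf K e ` K). dual_norm K e (\<Phi> - \<Psi>) < r)"
  using span_evalf_subset[OF assms]
  by (fastforce simp: free_space_def dual_topology_def dual_dist_def subset_iff
      Metric_space.metric_closure_of[OF Metric_space_dual] Metric_space.in_mball[OF Metric_space_dual])

lemma span_subset_free_space:
  assumes "e \<in> K" shows "fs.span (evalf K e ` K) \<subseteq> free_space K e"
  using span_evalf_subset[OF assms] unfolding free_space_def dual_topology_def
  by (intro closure_of_subset) (simp add: Metric_space.topspace_mtopology[OF Metric_space_dual])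

lemma dual_norm_scale:
  assumes "\<Phi> \<in> Lip0_dual K e"
  shows "dual_norm K e (fscale c \<Phi>) \<le> norm c * dual_norm K e \<Phi>"
proof (rule dual_norm_le)
  fix \<phi> :: "'a \<Rightarrow> 'b" assume "\<phi> \<in> Lip0 K e"
  then show "norm (fscale c \<Phi> \<phi>) \<le> norm c * dual_norm K e \<Phi> * lip_norm K \<phi>"
    using norm_le_dual_norm[OF assms] by (simp add: fscale_def norm_mult mult.assoc mult_left_mono)
qed (simp add: dual_norm_nonneg[OF assms])

lemma subspace_free_space:
  assumes "e \<in> K"
  shows "fs.subspace (free_space K e :: (('a::metric_space \<Rightarrow> 'k::real_normed_field) \<Rightarrow> 'k) set)"
proof (rule fs.subspaceI)
  note iff = in_free_space_iff[OF assms] and sub = subspace_Lip0_dual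
  note inD = subsetD[OF span_evalf_subset[OF assms]]
  show "0 \<in> (free_space K e :: (('a \<Rightarrow> 'k) \<Rightarrow> 'k) set)"
    using span_subset_free_space[OF assms] fs.span_zero by blast
  fix \<Phi> :: "('a \<Rightarrow> 'k) \<Rightarrow> 'k" assume \<Phi>: "\<Phi> \<in> free_space K e"
  show "\<Phi> + \<Psi> \<in> free_space K e" if \<Psi>: "\<Psi> \<in> free_space K e" for \<Psi>
    unfolding iff
  proof (intro conjI allI impI)
    show "\<Phi> + \<Psi> \<in> Lip0_dual K e" using \<Phi> \<Psi> by (simp add: iff fs.subspace_add[OF sub])
    fix r :: real assume "r > 0"
    then obtain A B where A: "A \<in> fs.span (evalf K e ` K)" "dual_norm K e (\<Phi> - A) < r / 2"
      and B: "B \<in> fs.span (evalf K e ` K)" "dual_norm K e (\<Psi> - B) < r / 2"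
      using \<Phi> \<Psi> unfolding iff by (meson half_gt_zero)
    have "dual_norm K e ((\<Phi> - A) + (\<Psi> - B)) < r"
      using A B \<Phi> \<Psi> dual_norm_triangle[of "\<Phi> - A" K e "\<Psi> - B"]
      by (simp add: iff inD fs.subspace_diff[OF sub])
    then show "\<exists>C\<in>fs.span (evalf K e ` K). dual_norm K e (\<Phi> + \<Psi> - C) < r"
      using A B by (intro bexI[of _ "A + B"]) (auto simp: fs.span_add algebra_simps)
  qed
  show "fscale c \<Phi> \<in> free_space K e" for c
    unfolding iff
  proof (intro conjI allI impI)
    show "fscale c \<Phi> \<in> Lip0_dual K e" using \<Phi> by (simp add: iff fs.subspace_scale[OF sub])
    fix r :: real assume r: "r > 0"
    define s where "s = r / (norm c + 1)"
    have "norm c + 1 > 0" by (simp add: add_nonneg_pos)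
    then have s: "s > 0" "norm c * s < r" using r by (auto simp: s_def field_simps)
    then obtain A where A: "A \<in> fs.span (evalf K e ` K)" "dual_norm K e (\<Phi> - A) < s"
      using \<Phi> unfolding iff by meson
    have "dual_norm K e (fscale c (\<Phi> - A)) \<le> norm c * dual_norm K e (\<Phi> - A)"
      using A \<Phi> by (intro dual_norm_scale) (simp add: iff inD fs.subspace_diff[OF sub])
    also have "\<dots> \<le> norm c * s" using A by (intro mult_left_mono) auto
    also have "\<dots> < r" by fact
    finally show "\<exists>C\<in>fs.span (evalf K e ` K). dual_norm K e (fscale c \<Phi> - C) < r"
      using A by (intro bexI[of _ "fscale c A"]) (auto simp: fs.span_scale fs.scale_right_diff_distrib)
  qed
qed

text \<open>The operator is the restriction of the adjoint of \<open>\<phi> \<mapsto> \<phi> \<circ> f - \<phi> (f e)\<close>.\<close>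

lemma lip_operator_unique_exists:
  fixes f :: "'a::metric_space \<Rightarrow> 'a"
  assumes e: "e \<in> K" and f: "f ` K \<subseteq> K" "L-lipschitz_on K f"
  shows "\<exists>!T :: (('a \<Rightarrow> 'k::real_normed_field) \<Rightarrow> 'k) \<Rightarrow> (('a \<Rightarrow> 'k) \<Rightarrow> 'k).
    bounded_operator K e T \<and> (\<forall>x\<in>K. T (evalf K e x) = evalf K e (f x) - evalf K e (f e))"
proof (rule ex_ex1I)
  let ?F = "free_space K e :: (('a \<Rightarrow> 'k) \<Rightarrow> 'k) set"
  let ?D = "Lip0_dual K e :: (('a \<Rightarrow> 'k) \<Rightarrow> 'k) set"
  let ?E = "fs.span (evalf K e ` K) :: (('a \<Rightarrow> 'k) \<Rightarrow> 'k) set"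
  note iff = in_free_space_iff[OF e]
  note subF = subspace_free_space[OF e, where 'k='k]
  have FD: "\<Phi> \<in> ?D" if "\<Phi> \<in> ?F" for \<Phi> using that iff by blast
  have EF: "\<Phi> \<in> ?F" if "\<Phi> \<in> ?E" for \<Phi> using that span_subset_free_space[OF e] by blast
  have fK: "f x \<in> K" if "x \<in> K" for x using f(1) that by blast
  have L: "0 \<le> L" using f(2) by (rule lipschitz_on_nonneg)
  define P where "P \<phi> = (\<lambda>x. if x \<in> K then \<phi> (f x) - \<phi> (f e) else 0)" for \<phi> :: "'a \<Rightarrow> 'k"
  have P_lip: "(L * lip_norm K \<phi>)-lipschitz_on K (P \<phi>)" if "\<phi> \<in> Lip0 K e" for \<phi> :: "'a \<Rightarrow> 'k"
  proof (rule lipschitz_onI)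
    fix x y assume xy: "x \<in> K" "y \<in> K"
    have "dist (P \<phi> x) (P \<phi> y) = dist (\<phi> (f x)) (\<phi> (f y))" using xy by (simp add: P_def dist_norm)
    also have "\<dots> \<le> lip_norm K \<phi> * dist (f x) (f y)"
      using lipschitz_onD[OF lip_norm[OF that]] xy fK by blast
    also have "\<dots> \<le> lip_norm K \<phi> * (L * dist x y)"
      using lipschitz_onD[OF f(2)] xy lip_norm_nonneg[OF that] by (intro mult_left_mono) auto
    finally show "dist (P \<phi> x) (P \<phi> y) \<le> L * lip_norm K \<phi> * dist x y" by (simp add: ac_simps)
  qed (use L lip_norm_nonneg[OF that] in auto)
  have P_in: "P \<phi> \<in> Lip0 K e" if "\<phi> \<in> Lip0 K e" for \<phi> :: "'a \<Rightarrow> 'k"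
    using P_lip[OF that] by (auto simp: Lip0_def P_def)
  have P_add: "P (\<phi> + \<psi>) = P \<phi> + P \<psi>" and P_scale: "P (fscale c \<phi>) = fscale c (P \<phi>)"
    for \<phi> \<psi> c by (auto simp: P_def fscale_def fun_eq_iff algebra_simps)
  define A where "A \<Phi> = (\<lambda>\<phi>. if \<phi> \<in> Lip0 K e then \<Phi> (P \<phi>) else 0)" for \<Phi> :: "('a \<Rightarrow> 'k) \<Rightarrow> 'k"
  have A_add: "A (\<Phi> + \<Psi>) = A \<Phi> + A \<Psi>" and A_scale: "A (fscale c \<Phi>) = fscale c (A \<Phi>)"
    and A_diff: "A (\<Phi> - \<Psi>) = A \<Phi> - A \<Psi>" for \<Phi> \<Psi> c
    by (auto simp: A_def fscale_def fun_eq_iff)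
  have A_bd: "norm (A \<Phi> \<phi>) \<le> L * dual_norm K e \<Phi> * lip_norm K \<phi>"
    if "\<Phi> \<in> ?D" "\<phi> \<in> Lip0 K e" for \<Phi> \<phi>
  proof -
    have "norm (A \<Phi> \<phi>) \<le> dual_norm K e \<Phi> * lip_norm K (P \<phi>)"
      using norm_le_dual_norm[OF that(1) P_in[OF that(2)]] that by (simp add: A_def)
    also have "\<dots> \<le> dual_norm K e \<Phi> * (L * lip_norm K \<phi>)"
      using lip_norm_le[OF P_lip[OF that(2)]] dual_norm_nonneg[OF that(1)] by (rule mult_left_mono)
    finally show ?thesis by (simp add: ac_simps)
  qed
  have A_norm: "dual_norm K e (A \<Phi>) \<le> L * dual_norm K e \<Phi>" if "\<Phi> \<in> ?D" for \<Phi>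
    using A_bd[OF that] L dual_norm_nonneg[OF that] by (intro dual_norm_le) auto
  have A_D: "A \<Phi> \<in> ?D" if "\<Phi> \<in> ?D" for \<Phi>
  proof -
    have "\<exists>C. \<forall>\<phi>\<in>Lip0 K e. norm (A \<Phi> \<phi>) \<le> C * lip_norm K \<phi>" using A_bd[OF that] by blast
    then show ?thesis
      using that P_in unfolding Lip0_dual_def mem_Collect_eq
      by (intro conjI) (auto simp: A_def P_add P_scale Lip0_closed)
  qed
  have A_evalf: "A (evalf K e x) = evalf K e (f x) - evalf K e (f e)" if "x \<in> K" for x
    using that P_in by (auto simp: A_def evalf_def fun_eq_iff P_def)
  have A_E: "A \<Phi> \<in> ?E" if "\<Phi> \<in> ?E" for \<Phi>
  proof -
    have "fs.subspace {\<Phi>. A \<Phi> \<in> ?E}"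
    proof (rule fs.subspaceI)
      have "A 0 = 0" by (auto simp: A_def)
      then show "0 \<in> {\<Phi>. A \<Phi> \<in> ?E}" by (simp add: fs.span_zero)
    qed (auto simp: A_add A_scale fs.span_add fs.span_scale)
    moreover have "evalf K e ` K \<subseteq> {\<Phi>. A \<Phi> \<in> ?E}"
      using A_evalf fK e by (auto intro!: fs.span_diff fs.span_base[OF imageI])
    ultimately show ?thesis using fs.span_minimal that by blast
  qed
  have A_F: "A \<Phi> \<in> ?F" if "\<Phi> \<in> ?F" for \<Phi>
    unfolding iff
  proof (intro conjI allI impI)
    show "A \<Phi> \<in> ?D" using A_D FD that by blast
    fix r :: real assume r: "r > 0"
    define s where "s = r / (L + 1)"
    have s: "s > 0" "L * s < r" using r L by (auto simp: s_def field_simps add_nonneg_pos)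
    obtain \<Psi> where \<Psi>: "\<Psi> \<in> ?E" "dual_norm K e (\<Phi> - \<Psi>) < s"
      using \<open>\<Phi> \<in> ?F\<close> s(1) unfolding iff by meson
    have "dual_norm K e (A \<Phi> - A \<Psi>) \<le> L * dual_norm K e (\<Phi> - \<Psi>)"
      using A_norm[of "\<Phi> - \<Psi>"] that \<Psi> FD EF fs.subspace_diff[OF subspace_Lip0_dual]
      by (metis A_diff)
    also have "\<dots> \<le> L * s" using \<Psi> L by (intro mult_left_mono) auto
    also have "\<dots> < r" by fact
    finally show "\<exists>\<Psi>\<in>?E. dual_norm K e (A \<Phi> - \<Psi>) < r" using A_E[OF \<Psi>(1)] by blast
  qed
  define T where "T \<Phi> = (if \<Phi> \<in> ?F then A \<Phi> else 0)" for \<Phi>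
  have "bounded_operator K e T"
    unfolding bounded_operator_def
  proof (intro conjI)
    show "\<exists>C. \<forall>\<Phi>\<in>?F. dual_norm K e (T \<Phi>) \<le> C * dual_norm K e \<Phi>"
      using A_norm FD by (auto simp: T_def)
  qed (use A_F fs.subspace_add[OF subF] fs.subspace_scale[OF subF]
       in \<open>auto simp: T_def A_add A_scale\<close>)
  moreover have "T (evalf K e x) = evalf K e (f x) - evalf K e (f e)" if "x \<in> K" for x
    using that EF[OF fs.span_base] A_evalf by (simp add: T_def)
  ultimately show "\<exists>T :: (('a \<Rightarrow> 'k) \<Rightarrow> 'k) \<Rightarrow> (('a \<Rightarrow> 'k) \<Rightarrow> 'k).
    bounded_operator K e T \<and> (\<forall>x\<in>K. T (evalf K e x) = evalf K e (f x) - evalf K e (f e))"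
    by blast

  fix T U :: "(('a \<Rightarrow> 'k) \<Rightarrow> 'k) \<Rightarrow> (('a \<Rightarrow> 'k) \<Rightarrow> 'k)"
  assume T: "bounded_operator K e T \<and> (\<forall>x\<in>K. T (evalf K e x) = evalf K e (f x) - evalf K e (f e))"
    and U: "bounded_operator K e U \<and> (\<forall>x\<in>K. U (evalf K e x) = evalf K e (f x) - evalf K e (f e))"
  show "T = U"
  proof
    fix \<Phi> :: "('a \<Rightarrow> 'k) \<Rightarrow> 'k"
    have T0: "T 0 = 0" if "bounded_operator K e T" for T :: "(('a \<Rightarrow> 'k) \<Rightarrow> 'k) \<Rightarrow> (('a \<Rightarrow> 'k) \<Rightarrow> 'k)"
    proof -
      have "T (0 + 0) = T 0 + T 0"
        using that fs.subspace_0[OF subF] unfolding bounded_operator_def by blast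
      then show ?thesis by simp
    qed
    have Tdiff: "T (\<Phi> - \<Psi>) = T \<Phi> - T \<Psi>"
      if "bounded_operator K e T" "\<Phi> \<in> ?F" "\<Psi> \<in> ?F"
      for T :: "(('a \<Rightarrow> 'k) \<Rightarrow> 'k) \<Rightarrow> (('a \<Rightarrow> 'k) \<Rightarrow> 'k)" and \<Phi> \<Psi>
    proof -
      have "T (\<Phi> - \<Psi> + \<Psi>) = T (\<Phi> - \<Psi>) + T \<Psi>"
        using that fs.subspace_diff[OF subF] unfolding bounded_operator_def by blast
      then show ?thesis by (simp add: algebra_simps)
    qed
    have eqE: "T \<Psi> = U \<Psi>" if "\<Psi> \<in> ?E" for \<Psi>
    proof -
      have "fs.subspace {\<Psi>\<in>?F. T \<Psi> = U \<Psi>}"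
      proof (rule fs.subspaceI)
        show "0 \<in> {\<Psi>\<in>?F. T \<Psi> = U \<Psi>}" using T U T0 fs.subspace_0[OF subF] by simp
        show "\<Phi> + \<Psi> \<in> {\<Psi>\<in>?F. T \<Psi> = U \<Psi>}"
          if "\<Phi> \<in> {\<Psi>\<in>?F. T \<Psi> = U \<Psi>}" "\<Psi> \<in> {\<Psi>\<in>?F. T \<Psi> = U \<Psi>}" for \<Phi> \<Psi>
          using that T U by (simp add: bounded_operator_def fs.subspace_add[OF subF])
        show "fscale c \<Phi> \<in> {\<Psi>\<in>?F. T \<Psi> = U \<Psi>}" if "\<Phi> \<in> {\<Psi>\<in>?F. T \<Psi> = U \<Psi>}" for c \<Phi>
          using that T U by (simp add: bounded_operator_def fs.subspace_scale[OF subF])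
      qed
      moreover have "evalf K e ` K \<subseteq> {\<Psi>\<in>?F. T \<Psi> = U \<Psi>}"
        using T U by (auto intro: EF[OF fs.span_base[OF imageI]])
      ultimately show ?thesis using fs.span_minimal that by blast
    qed
    show "T \<Phi> = U \<Phi>"
    proof (cases "\<Phi> \<in> ?F")
      case False
      then show ?thesis using T U by (simp add: bounded_operator_def)
    next
      case True
      obtain C1 C2 where C: "\<forall>\<Phi>\<in>?F. dual_norm K e (T \<Phi>) \<le> C1 * dual_norm K e \<Phi>"
        "\<forall>\<Phi>\<in>?F. dual_norm K e (U \<Phi>) \<le> C2 * dual_norm K e \<Phi>"
        using T U unfolding bounded_operator_def by blast
      have TU: "T \<Phi> \<in> ?F" "U \<Phi> \<in> ?F" using T U True unfolding bounded_operator_def by blast+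
      define C where "C = \<bar>C1\<bar> + \<bar>C2\<bar>"
      have "dual_norm K e (T \<Phi> - U \<Phi>) \<le> 0 + r" if r: "r > 0" for r
      proof -
        have "r / (C + 1) > 0" using r by (simp add: C_def add_nonneg_pos)
        then obtain \<Psi> where \<Psi>: "\<Psi> \<in> ?E" "dual_norm K e (\<Phi> - \<Psi>) < r / (C + 1)"
          using True unfolding iff by meson
        let ?d = "\<Phi> - \<Psi>"
        have d: "?d \<in> ?F" using True EF[OF \<Psi>(1)] by (rule fs.subspace_diff[OF subF])
        have Td: "T ?d \<in> ?D" "U ?d \<in> ?D" using T U d FD unfolding bounded_operator_def by blast+
        have n: "0 \<le> dual_norm K e ?d" using dual_norm_nonneg FD d by blast
        have "T \<Phi> - U \<Phi> = T ?d + (0 - U ?d)"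
          using Tdiff[OF conjunct1[OF T] True EF[OF \<Psi>(1)]]
            Tdiff[OF conjunct1[OF U] True EF[OF \<Psi>(1)]] eqE[OF \<Psi>(1)] by (simp add: fun_eq_iff)
        then have "dual_norm K e (T \<Phi> - U \<Phi>) \<le> dual_norm K e (T ?d) + dual_norm K e (0 - U ?d)"
          using dual_norm_triangle Td fs.subspace_diff[OF subspace_Lip0_dual]
            fs.subspace_0[OF subspace_Lip0_dual] by metis
        also have "dual_norm K e (0 - U ?d) = dual_norm K e (U ?d)"
          by (subst dual_norm_minus_commute) simp
        also have "dual_norm K e (T ?d) + dual_norm K e (U ?d) \<le>
          C1 * dual_norm K e ?d + C2 * dual_norm K e ?d" using C d by (intro add_mono) auto
        also have "\<dots> \<le> (C + 1) * dual_norm K e ?d"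
          unfolding distrib_right[symmetric] using n by (intro mult_right_mono) (auto simp: C_def)
        also have "\<dots> \<le> r"
          using \<Psi>(2) by (simp add: C_def field_simps add_nonneg_pos)
        finally show ?thesis by (simp only: add_0)
      qed
      then have "dual_norm K e (T \<Phi> - U \<Phi>) \<le> 0" by (rule field_le_epsilon)
      moreover have D: "T \<Phi> - U \<Phi> \<in> ?D" using TU FD fs.subspace_diff[OF subspace_Lip0_dual] by blast
      ultimately have "T \<Phi> - U \<Phi> = 0" using dual_norm_eq_0 dual_norm_nonneg order_antisym by blast
      then show ?thesis by simp
    qed
  qed
qed

end

(*
  Let N be the space of functions in Lip0(K, e) that are constant on every connected subset of K.
  As f is continuous, the map phi |-> phi o f - phi (f e), whose adjoint is T_{f,e}, preserves N,
  so the annihilator of N in the free space is a closed invariant subspace.  It contains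
  delta(x) - delta(y) for distinct x and y in a common component.  Since K is compact and
  disconnected, it splits into two closed pieces at positive distance; the normalised indicator of
  one piece is Lipschitz and lies in N, so the annihilator is not the whole space.
*)

theory Submission
  imports Defs
begin

text \<open>This is the map whose adjoint acts as the operator on the free space. Subtracting
  \<open>\<phi> (f e)\<close> restores the zero at \<open>e\<close>, which \<open>f\<close> need not
  fix.\<close>

definition lip_pullback ::
    "'a set \<Rightarrow> 'a \<Rightarrow> ('a \<Rightarrow> 'a) \<Rightarrow> ('a \<Rightarrow> 'k::real_normed_field) \<Rightarrow> ('a \<Rightarrow> 'k)"
  where "lip_pullback K e f \<phi> = (\<lambda>x. if x \<in> K then \<phi> (f x) - \<phi> (f e) else 0)"

text \<open>Quantifying over all connected subsets gives the same space as quantifying over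
  components, since each nonempty one lies in a component. It makes invariance direct: the image
  under \<open>f\<close> of a component is connected but need not be a component.\<close>

definition connected_constant ::
    "'a::metric_space set \<Rightarrow> 'a \<Rightarrow> ('a \<Rightarrow> 'k::real_normed_field) set"
  where "connected_constant K e =
    {\<phi>\<in>Lip0 K e. \<forall>C\<subseteq>K. connected C \<longrightarrow> (\<forall>x\<in>C. \<forall>y\<in>C. \<phi> x = \<phi> y)}"

definition annihilator ::
    "'a::metric_space set \<Rightarrow> 'a \<Rightarrow> ('a \<Rightarrow> 'k::real_normed_field) set \<Rightarrow>
     (('a \<Rightarrow> 'k) \<Rightarrow> 'k) set"
  where "annihilator K e N = {\<Phi>\<in>free_space K e. \<forall>\<phi>\<in>N. \<Phi> \<phi> = 0}"

section \<open>The operator as an adjoint\<close>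

lemma lip_pullback_in_Lip0:
  fixes \<phi> :: "'a::metric_space \<Rightarrow> 'k::real_normed_field"
  assumes "f ` K \<subseteq> K" "L-lipschitz_on K f" "\<phi> \<in> Lip0 K e"
  shows "lip_pullback K e f \<phi> \<in> Lip0 K e"
proof -
  obtain M where "M-lipschitz_on K \<phi>" using assms(3) by (auto simp: Lip0_def)
  then have "M-lipschitz_on (f ` K) \<phi>" using assms(1) by (rule lipschitz_on_subset)
  then have "(M * L)-lipschitz_on K (\<lambda>x. \<phi> (f x))" by (rule lipschitz_on_compose2[OF assms(2)])
  then have "(M * L)-lipschitz_on K (lip_pullback K e f \<phi>)"
    by (auto simp: lipschitz_on_def lip_pullback_def dist_norm)
  then show ?thesis by (auto simp: Lip0_def lip_pullback_def)
qed

lemma lip_operator_props: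
  fixes f :: "'a::metric_space \<Rightarrow> 'a"
  assumes "e \<in> K" "f ` K \<subseteq> K" "L-lipschitz_on K f"
  defines "T \<equiv> lip_operator K e f :: (('a \<Rightarrow> 'k::real_normed_field) \<Rightarrow> 'k) \<Rightarrow> (('a \<Rightarrow> 'k) \<Rightarrow> 'k)"
  shows "bounded_operator K e T"
    and "\<And>x. x \<in> K \<Longrightarrow> T (evalf K e x) = evalf K e (f x) - evalf K e (f e)"
  using theI'[OF lip_operator_unique_exists[OF assms(1-3), where 'k='k]]
  unfolding T_def lip_operator_def by blast+

text \<open>The definite description provides only linearity, boundedness and the values at
  evaluation functionals. Both sides are linear and continuous in \<open>\<Phi>\<close> and agree at
  each \<open>evalf K e x\<close>, hence on the span, hence by density on the free space.\<close>

lemma lip_operator_apply: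
  fixes f :: "'a::metric_space \<Rightarrow> 'a" and \<Phi> :: "('a \<Rightarrow> 'k::real_normed_field) \<Rightarrow> 'k"
  assumes e: "e \<in> K" and f: "f ` K \<subseteq> K" "L-lipschitz_on K f"
    and \<Phi>: "\<Phi> \<in> free_space K e" and \<phi>: "\<phi> \<in> Lip0 K e"
  shows "lip_operator K e f \<Phi> \<phi> = \<Phi> (lip_pullback K e f \<phi>)"
proof -
  let ?F = "free_space K e :: (('a \<Rightarrow> 'k) \<Rightarrow> 'k) set"
  let ?E = "fs.span (evalf K e ` K) :: (('a \<Rightarrow> 'k) \<Rightarrow> 'k) set"
  define T where "T = (lip_operator K e f :: (('a \<Rightarrow> 'k) \<Rightarrow> 'k) \<Rightarrow> (('a \<Rightarrow> 'k) \<Rightarrow> 'k))"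
  define \<psi> where "\<psi> = lip_pullback K e f \<phi>"
  have \<psi>: "\<psi> \<in> Lip0 K e" unfolding \<psi>_def by (rule lip_pullback_in_Lip0[OF f \<phi>])
  have T: "bounded_operator K e T" unfolding T_def by (rule lip_operator_props(1)[OF e f])
  have T_evalf: "T (evalf K e x) = evalf K e (f x) - evalf K e (f e)" if "x \<in> K" for x
    unfolding T_def using that by (rule lip_operator_props(2)[OF e f])
  note subF = subspace_free_space[OF e, where 'k='k]
  have EF: "\<Psi> \<in> ?F" if "\<Psi> \<in> ?E" for \<Psi> using that span_subset_free_space[OF e] by blast
  have FD: "\<Psi> \<in> Lip0_dual K e" if "\<Psi> \<in> ?F" for \<Psi> using that in_free_space_iff[OF e] by blast
  have TF: "T \<Psi> \<in> ?F" if "\<Psi> \<in> ?F" for \<Psi>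
    using T that unfolding bounded_operator_def by blast
  have T_add: "T (\<Psi> + \<Theta>) = T \<Psi> + T \<Theta>" if "\<Psi> \<in> ?F" "\<Theta> \<in> ?F" for \<Psi> \<Theta>
    using T that unfolding bounded_operator_def by blast
  have T_scale: "T (fscale c \<Psi>) = fscale c (T \<Psi>)" if "\<Psi> \<in> ?F" for c \<Psi>
    using T that unfolding bounded_operator_def by blast
  obtain C where C: "dual_norm K e (T \<Psi>) \<le> C * dual_norm K e \<Psi>" if "\<Psi> \<in> ?F" for \<Psi>
    using T unfolding bounded_operator_def by blast
  have "fs.subspace {\<Psi>\<in>?F. T \<Psi> \<phi> = \<Psi> \<psi>}"
  proof (rule fs.subspaceI)
    have "T 0 + T 0 = T 0" using T_add[of 0 0] fs.subspace_0[OF subF] by simp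
    then show "0 \<in> {\<Psi>\<in>?F. T \<Psi> \<phi> = \<Psi> \<psi>}" using fs.subspace_0[OF subF] by simp
  qed (auto simp: T_add T_scale fs.subspace_add[OF subF] fs.subspace_scale[OF subF], simp add: fscale_def)
  moreover have "T (evalf K e x) \<phi> = evalf K e x \<psi>" if "x \<in> K" for x
    using that \<phi> \<psi> unfolding T_evalf[OF that]
    by (simp add: evalf_def) (simp add: \<psi>_def lip_pullback_def)
  then have "evalf K e ` K \<subseteq> {\<Psi>\<in>?F. T \<Psi> \<phi> = \<Psi> \<psi>}"
    using EF[OF fs.span_base] by auto
  ultimately have on_span: "T \<Psi> \<phi> = \<Psi> \<psi>" if "\<Psi> \<in> ?E" for \<Psi>
    using fs.span_minimal that by blast
  \<comment> \<open>\<open>B\<close> bounds the norm of the functional sending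
    \<open>\<Delta>\<close> to \<open>T \<Delta> \<phi> - \<Delta> \<psi>\<close>. The absolute
    value is there because the constant \<open>C\<close> may be negative.\<close>
  define B where "B = \<bar>C\<bar> * lip_norm K \<phi> + lip_norm K \<psi>"
  have B: "0 \<le> B" using lip_norm_nonneg[OF \<phi>] lip_norm_nonneg[OF \<psi>] by (simp add: B_def)
  have "norm (T \<Phi> \<phi> - \<Phi> \<psi>) \<le> 0 + r" if r: "r > 0" for r
  proof -
    \<comment> \<open>The divisor is \<open>B + 1\<close> because \<open>B\<close> may be
      zero.\<close>
    have "r / (B + 1) > 0" using r B by (simp add: add_nonneg_pos)
    then obtain \<Psi> where \<Psi>: "\<Psi> \<in> ?E" "dual_norm K e (\<Phi> - \<Psi>) < r / (B + 1)"
      using \<Phi> unfolding in_free_space_iff[OF e] by meson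
    define \<Delta> where "\<Delta> = \<Phi> - \<Psi>"
    have \<Delta>: "\<Delta> \<in> ?F" unfolding \<Delta>_def by (rule fs.subspace_diff[OF subF \<Phi> EF[OF \<Psi>(1)]])
    have n: "0 \<le> dual_norm K e \<Delta>" using dual_norm_nonneg FD \<Delta> by blast
    have "T \<Phi> = T \<Delta> + T \<Psi>" using T_add[OF \<Delta> EF[OF \<Psi>(1)]] by (simp add: \<Delta>_def)
    then have "T \<Phi> \<phi> - \<Phi> \<psi> = T \<Delta> \<phi> - \<Delta> \<psi>" using on_span[OF \<Psi>(1)] by (simp add: \<Delta>_def)
    then have "norm (T \<Phi> \<phi> - \<Phi> \<psi>) \<le> norm (T \<Delta> \<phi>) + norm (\<Delta> \<psi>)"
      by (simp add: norm_triangle_ineq4)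
    also have "\<dots> \<le> dual_norm K e (T \<Delta>) * lip_norm K \<phi> + dual_norm K e \<Delta> * lip_norm K \<psi>"
      using \<Delta> FD TF \<phi> \<psi> by (intro add_mono norm_le_dual_norm) auto
    also have "\<dots> \<le> (\<bar>C\<bar> * dual_norm K e \<Delta>) * lip_norm K \<phi> + dual_norm K e \<Delta> * lip_norm K \<psi>"
      using order_trans[OF C[OF \<Delta>] mult_right_mono[OF abs_ge_self n]]
        lip_norm_nonneg[OF \<phi>] lip_norm_nonneg[OF \<psi>]
      by (intro add_mono mult_right_mono) auto
    also have "\<dots> = B * dual_norm K e \<Delta>" by (simp add: B_def algebra_simps)
    also have "\<dots> \<le> (B + 1) * dual_norm K e \<Delta>" using n by (simp add: algebra_simps)
    also have "\<dots> \<le> r" using \<Psi>(2) B by (simp add: \<Delta>_def field_simps add_nonneg_pos)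
    finally show ?thesis by simp
  qed
  then have "norm (T \<Phi> \<phi> - \<Phi> \<psi>) \<le> 0" by (rule field_le_epsilon)
  then show ?thesis by (simp add: T_def \<psi>_def)
qed

section \<open>Annihilators are closed subspaces\<close>

text \<open>For fixed \<open>\<phi>\<close> the value \<open>\<Phi> \<phi>\<close> depends
  continuously on \<open>\<Phi>\<close>. So the common zero set is closed in the whole dual, and its
  trace on the free space is closed there.\<close>

lemma closedin_annihilator:
  fixes N :: "('a::metric_space \<Rightarrow> 'k::real_normed_field) set"
  assumes e: "e \<in> K" and N: "N \<subseteq> Lip0 K e"
  shows "closedin (free_topology K e) (annihilator K e N)"
proof -
  let ?D = "Lip0_dual K e :: (('a \<Rightarrow> 'k) \<Rightarrow> 'k) set"
  let ?A = "{\<Phi>\<in>?D. \<forall>\<phi>\<in>N. \<Phi> \<phi> = 0}"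
  interpret M: Metric_space ?D "dual_dist K e" by (rule Metric_space_dual)
  have "\<exists>r>0. disjnt ?A (M.mball \<Phi> r)" if \<Phi>A: "\<Phi> \<in> ?D - ?A" for \<Phi>
  proof -
    obtain \<phi> where \<phi>: "\<phi> \<in> N" "\<Phi> \<phi> \<noteq> 0" using \<Phi>A by blast
    have \<Phi>: "\<Phi> \<in> ?D" using \<Phi>A by blast
    have \<phi>L: "\<phi> \<in> Lip0 K e" using \<phi> N by blast
    define b where "b = lip_norm K \<phi> + 1"
    have b: "b > 0" using lip_norm_nonneg[OF \<phi>L] by (simp add: b_def)
    \<comment> \<open>Since \<open>\<Psi>\<close> kills \<open>\<phi>\<close>, the value
      \<open>\<Phi> \<phi>\<close> is that of \<open>\<Phi> - \<Psi>\<close>, so its size bounds the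
      distance from below. The ball of this radius therefore misses \<open>?A\<close>.\<close>
    have "norm (\<Phi> \<phi>) / b \<le> dual_dist K e \<Phi> \<Psi>" if \<Psi>: "\<Psi> \<in> ?A" for \<Psi>
    proof -
      have d: "\<Phi> - \<Psi> \<in> ?D" using \<Phi> \<Psi> fs.subspace_diff[OF subspace_Lip0_dual] by blast
      have "norm (\<Phi> \<phi>) = norm ((\<Phi> - \<Psi>) \<phi>)" using \<Psi> \<phi> by simp
      also have "\<dots> \<le> dual_norm K e (\<Phi> - \<Psi>) * lip_norm K \<phi>"
        by (rule norm_le_dual_norm[OF d \<phi>L])
      also have "\<dots> \<le> dual_norm K e (\<Phi> - \<Psi>) * b"
        using dual_norm_nonneg[OF d] by (intro mult_left_mono) (auto simp: b_def)
      finally show ?thesis using b \<Phi> \<Psi> by (simp add: dual_dist_def divide_le_eq)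
    qed
    then have "disjnt ?A (M.mball \<Phi> (norm (\<Phi> \<phi>) / b))"
      by (fastforce simp: disjnt_iff M.in_mball)
    then show ?thesis using b \<phi> by (intro exI[of _ "norm (\<Phi> \<phi>) / b"]) auto
  qed
  then have "closedin (dual_topology K e) ?A" unfolding dual_topology_def M.closedin_metric by blast
  moreover have "annihilator K e N = ?A \<inter> free_space K e"
    using in_free_space_iff[OF e] by (auto simp: annihilator_def)
  ultimately show ?thesis unfolding free_topology_def closedin_subtopology by blast
qed

lemma subspace_annihilator:
  fixes N :: "('a::metric_space \<Rightarrow> 'k::real_normed_field) set"
  assumes "e \<in> K"
  shows "fs.subspace (annihilator K e N)"
proof -
  note sub = subspace_free_space[OF assms, where 'k='k]
  show ?thesis
    by (rule fs.subspaceI)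
      (auto simp: annihilator_def fs.subspace_0[OF sub] fs.subspace_add[OF sub]
        fs.subspace_scale[OF sub], simp add: fscale_def)
qed

section \<open>Functions constant on connected sets\<close>

text \<open>A Lipschitz map sends a connected \<open>C\<close> to a connected subset of
  \<open>K\<close>, where \<open>\<phi>\<close> is constant. The subtracted
  \<open>\<phi> (f e)\<close> is the same at both points.\<close>

lemma lip_pullback_connected_constant:
  assumes f: "f ` K \<subseteq> K" "L-lipschitz_on K f" and \<phi>: "\<phi> \<in> connected_constant K e"
  shows "lip_pullback K e f \<phi> \<in> connected_constant K e"
  unfolding connected_constant_def mem_Collect_eq
proof (intro conjI allI impI ballI)
  show "lip_pullback K e f \<phi> \<in> Lip0 K e"
    using \<phi> by (intro lip_pullback_in_Lip0[OF f]) (simp add: connected_constant_def)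
  fix C x y assume C: "C \<subseteq> K" "connected C" "x \<in> C" "y \<in> C"
  have "connected (f ` C)"
    by (rule connected_continuous_image
        [OF continuous_on_subset[OF lipschitz_on_continuous_on[OF f(2)] C(1)] C(2)])
  moreover have "f ` C \<subseteq> K" using f C by blast
  ultimately have "\<phi> (f x) = \<phi> (f y)" using \<phi> C unfolding connected_constant_def by blast
  then show "lip_pullback K e f \<phi> x = lip_pullback K e f \<phi> y"
    using C by (simp add: lip_pullback_def subset_iff)
qed

text \<open>This makes the difference of two evaluation functionals a nonzero element of the
  annihilator.\<close>

lemma evalf_inj:
  fixes K :: "'a::metric_space set"
  assumes "x \<in> K" "y \<in> K"
    and "(evalf K e x :: ('a \<Rightarrow> 'k::real_normed_field) \<Rightarrow> 'k) = evalf K e y"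
  shows "x = y"
proof -
  \<comment> \<open>The distance from \<open>x\<close>, shifted to vanish at \<open>e\<close>,
    separates \<open>x\<close> from every other point of \<open>K\<close>.\<close>
  define \<phi> where "\<phi> z = (if z \<in> K then of_real (dist x z - dist x e) else 0 :: 'k)" for z
  have "\<bar>dist x z - dist x w\<bar> \<le> dist z w" for z w
    using dist_triangle[of x z w] dist_triangle[of x w z] by (simp add: dist_commute abs_le_iff)
  then have "1-lipschitz_on K \<phi>"
    by (intro lipschitz_onI) (simp_all add: \<phi>_def dist_of_real dist_real_def flip: of_real_diff)
  then have "\<phi> \<in> Lip0 K e" by (auto simp: Lip0_def \<phi>_def)
  then have "\<phi> x = \<phi> y" using fun_cong[OF assms(3), of \<phi>] by (simp add: evalf_def)
  then show ?thesis using assms(1,2) unfolding \<phi>_def by (simp only: if_True of_real_eq_iff) simp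
qed

text \<open>A function that is not constant on \<open>K\<close> yields a difference of evaluation
  functionals outside the annihilator, which makes the annihilator proper.\<close>

lemma connected_constant_separates:
  fixes K :: "'a::metric_space set"
  assumes K: "compact K" "\<not> connected K" and e: "e \<in> K"
  obtains \<phi> :: "'a \<Rightarrow> 'k::real_normed_field" and x y
    where "\<phi> \<in> connected_constant K e" "x \<in> K" "y \<in> K" "\<phi> x \<noteq> \<phi> y"
proof -
  obtain A B where AB: "closed A" "closed B" "K \<subseteq> A \<union> B" "A \<inter> B \<inter> K = {}"
      "A \<inter> K \<noteq> {}" "B \<inter> K \<noteq> {}"
    using K(2) unfolding connected_closed by metis
  have "compact (A \<inter> K)" using AB(1) K(1) by (rule closed_Int_compact)
  moreover have "continuous_on (A \<inter> K) (\<lambda>z. infdist z (B \<inter> K))"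
    by (intro continuous_on_infdist continuous_on_id)
  \<comment> \<open>By compactness some \<open>w\<close> in \<open>A \<inter> K\<close> is nearest
    to \<open>B \<inter> K\<close>. Its distance \<open>d\<close> is positive because
    \<open>B \<inter> K\<close> is closed and does not contain \<open>w\<close>.\<close>
  ultimately obtain w where w: "w \<in> A \<inter> K"
      "\<And>z. z \<in> A \<inter> K \<Longrightarrow> infdist w (B \<inter> K) \<le> infdist z (B \<inter> K)"
    using continuous_attains_inf AB(5) by metis
  define d where "d = infdist w (B \<inter> K)"
  have "closed (B \<inter> K)" using AB(2) K(1) by (simp add: closed_Int compact_imp_closed)
  then have "d \<noteq> 0"
    using in_closed_iff_infdist_zero[of "B \<inter> K" w] AB(4,6) w(1) by (auto simp: d_def)
  then have "d > 0" using infdist_nonneg[of w "B \<inter> K"] by (simp add: d_def)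
  moreover have "d \<le> dist x y" if "x \<in> A \<inter> K" "y \<in> B \<inter> K" for x y
    using w(2)[OF that(1)] infdist_le[OF that(2), of x] by (simp add: d_def)
  ultimately have d: "d > 0" "\<And>x y. x \<in> A \<inter> K \<Longrightarrow> y \<in> B \<inter> K \<Longrightarrow> d \<le> dist x y" by auto
  define ind where "ind z = (if z \<in> A then 1 else 0 :: 'k)" for z
  define \<phi> where "\<phi> z = (if z \<in> K then ind z - ind e else 0)" for z
  \<comment> \<open>The function jumps by 1 only between points in different pieces, and these are
    at least \<open>d\<close> apart.\<close>
  have "(1 / d)-lipschitz_on K \<phi>"
  proof (rule lipschitz_onI)
    fix x y assume xy: "x \<in> K" "y \<in> K"
    show "dist (\<phi> x) (\<phi> y) \<le> 1 / d * dist x y"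
    proof (cases "x \<in> A \<longleftrightarrow> y \<in> A")
      case False
      then have "d \<le> dist x y" using xy AB(3) d(2)[of x y] d(2)[of y x] by (auto simp: dist_commute)
      then show ?thesis using xy False d(1) by (auto simp: \<phi>_def ind_def dist_norm)
    qed (use xy d(1) in \<open>auto simp: \<phi>_def ind_def\<close>)
  qed (use d(1) in auto)
  then have "\<phi> \<in> Lip0 K e" by (auto simp: Lip0_def \<phi>_def)
  moreover have "\<phi> x = \<phi> y" if "C \<subseteq> K" "connected C" "x \<in> C" "y \<in> C" for C x y
  proof -
    \<comment> \<open>A connected set cannot meet both pieces, so the indicator is constant on
      it.\<close>
    have "A \<inter> C = {} \<or> B \<inter> C = {}"
      using AB that by (intro connected_closedD[OF that(2)]) auto
    then show ?thesis using AB(3) that by (auto simp: \<phi>_def ind_def)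
  qed
  ultimately have "\<phi> \<in> connected_constant K e" unfolding connected_constant_def by blast
  moreover obtain x y where "x \<in> A \<inter> K" "y \<in> B \<inter> K" using AB by blast
  moreover from this have "\<phi> x \<noteq> \<phi> y" using AB(4) by (auto simp: \<phi>_def ind_def)
  ultimately show thesis using that by blast
qed

text \<open>Keeping the scalar type general lets one proof serve both the real and the complex
  case.\<close>

lemma nontrivial_invariant_annihilator:
  fixes K :: "'a::metric_space set" and f :: "'a \<Rightarrow> 'a"
  assumes K: "compact K" "\<not> connected K"
    and C: "C \<subseteq> K" "connected C" "a \<in> C" "b \<in> C" "a \<noteq> b"
    and e: "e \<in> K" and f: "f ` K \<subseteq> K" "L-lipschitz_on K f"
  shows "nontrivial_invariant_subspace K e
    (lip_operator K e f :: (('a \<Rightarrow> 'k::real_normed_field) \<Rightarrow> 'k) \<Rightarrow> (('a \<Rightarrow> 'k) \<Rightarrow> 'k))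
    (annihilator K e (connected_constant K e))"
proof -
  let ?F = "free_space K e :: (('a \<Rightarrow> 'k) \<Rightarrow> 'k) set"
  let ?T = "lip_operator K e f :: (('a \<Rightarrow> 'k) \<Rightarrow> 'k) \<Rightarrow> (('a \<Rightarrow> 'k) \<Rightarrow> 'k)"
  define N where "N = (connected_constant K e :: ('a \<Rightarrow> 'k) set)"
  let ?S = "annihilator K e N"
  have N: "N \<subseteq> Lip0 K e" by (auto simp: N_def connected_constant_def)
  have evalf_F: "evalf K e x - evalf K e y \<in> ?F" if "x \<in> K" "y \<in> K" for x y
    using that by (intro subsetD[OF span_subset_free_space[OF e]] fs.span_diff fs.span_base imageI)
  have evalf_N: "(evalf K e x - evalf K e y) \<phi> = \<phi> x - \<phi> y" if "\<phi> \<in> N" for x y \<phi>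
    using that N by (auto simp: evalf_def)
  have sub: "fs.subspace ?S" by (rule subspace_annihilator[OF e])
  \<comment> \<open>Both points lie in the connected set \<open>C\<close>, so functions in
    \<open>N\<close> cannot tell them apart.\<close>
  have "evalf K e a - evalf K e b \<in> ?S"
    unfolding annihilator_def mem_Collect_eq
  proof (intro conjI ballI)
    show "evalf K e a - evalf K e b \<in> ?F" using C by (intro evalf_F) auto
    fix \<phi> :: "'a \<Rightarrow> 'k" assume \<phi>: "\<phi> \<in> N"
    then have "\<phi> a = \<phi> b" using C unfolding N_def connected_constant_def by blast
    then show "(evalf K e a - evalf K e b) \<phi> = 0" using evalf_N[OF \<phi>, of a b] by simp
  qed
  moreover have "evalf K e a - evalf K e b \<noteq> (0 :: ('a \<Rightarrow> 'k) \<Rightarrow> 'k)"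
    using evalf_inj[of a K b e, where 'k='k] C by auto
  ultimately have "{0} \<subset> ?S" using fs.subspace_0[OF sub] by blast
  moreover have "?S \<subset> ?F"
  proof -
    obtain \<phi> :: "'a \<Rightarrow> 'k" and x y where \<phi>: "\<phi> \<in> N" "x \<in> K" "y \<in> K" "\<phi> x \<noteq> \<phi> y"
      using connected_constant_separates[OF K e] unfolding N_def by metis
    then have "evalf K e x - evalf K e y \<notin> ?S"
      using evalf_N[OF \<phi>(1), of x y] unfolding annihilator_def by force
    then show ?thesis using evalf_F[OF \<phi>(2,3)] unfolding annihilator_def by blast
  qed
  moreover have "?T ` ?S \<subseteq> ?S"
  proof (rule image_subsetI)
    fix \<Phi> assume \<Phi>: "\<Phi> \<in> ?S"
    then have \<Phi>F: "\<Phi> \<in> ?F" by (simp add: annihilator_def)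
    \<comment> \<open>The adjoint formula moves the operator onto \<open>\<phi>\<close>, whose
      pullback stays in \<open>N\<close> and is thus killed by \<open>\<Phi>\<close>.\<close>
    have "?T \<Phi> \<phi> = 0" if "\<phi> \<in> N" for \<phi>
    proof -
      have "lip_pullback K e f \<phi> \<in> N"
        using lip_pullback_connected_constant[OF f] that unfolding N_def by blast
      then have "\<Phi> (lip_pullback K e f \<phi>) = 0" using \<Phi> by (simp add: annihilator_def)
      then show ?thesis using lip_operator_apply[OF e f \<Phi>F subsetD[OF N that]] by simp
    qed
    moreover have "?T \<Phi> \<in> ?F"
      using lip_operator_props(1)[OF e f] \<Phi>F unfolding bounded_operator_def by blast
    ultimately show "?T \<Phi> \<in> ?S" unfolding annihilator_def by blast
  qed
  ultimately show ?thesis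
    unfolding nontrivial_invariant_subspace_def N_def[symmetric]
    by (intro conjI sub closedin_annihilator[OF e N])
qed

theorem corollary4p8:
  fixes K :: "'a::metric_space set" and e :: 'a and f :: "'a \<Rightarrow> 'a"
  assumes "infinite K" and "compact K"
    and "\<exists>C1\<in>components K. \<exists>C2\<in>components K. C1 \<noteq> C2"
    and "\<exists>C\<in>components K. \<exists>x\<in>C. \<exists>y\<in>C. x \<noteq> y"
    and "e \<in> K"
    and "f ` K \<subseteq> K" and "\<exists>L. L-lipschitz_on K f"
  shows "(\<exists>S. nontrivial_invariant_subspace K e
            (lip_operator K e f :: (('a \<Rightarrow> real) \<Rightarrow> real) \<Rightarrow> (('a \<Rightarrow> real) \<Rightarrow> real)) S) \<and>
         (\<exists>S. nontrivial_invariant_subspace K e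
            (lip_operator K e f :: (('a \<Rightarrow> complex) \<Rightarrow> complex) \<Rightarrow> (('a \<Rightarrow> complex) \<Rightarrow> complex)) S)"
proof -
  have disconnected: "\<not> connected K"
    using assms(3) connected_eq_connected_components_eq by metis
  obtain C a b where C: "C \<in> components K" "a \<in> C" "b \<in> C" "a \<noteq> b"
    using assms(4) by blast
  obtain L where L: "L-lipschitz_on K f" using assms(7) by blast
  note * = nontrivial_invariant_annihilator[OF assms(2) disconnected
      in_components_subset[OF C(1)] in_components_connected[OF C(1)] C(2-4) assms(5,6) L]
  show ?thesis using *[where 'k=real] *[where 'k=complex] by blast
qed

end
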